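(* Consider a Markov decision process $(r,\Gamma,\beta,P)$ with state space $\mathsf X$ and action space $\mathsf A$ satisfying the standing assumptions described in the context, and let $\sigma\in\Sigma$. If $P_\sigma$ is open set irreducible and $\sigma$ is continuous (as a map $\mathsf X\to\mathsf A$), then the following three statements are equivalent: (E1) there exists $x\in\mathsf X$ such that $v_s(x)\le v_\sigma(x)$ for all $s\in\Sigma$; (E2) there exists a Borel probability measure $\rho$ on $\mathsf X$ such that $\int v_s\,\mathrm d\rho\le\int v_\sigma\,\mathrm d\rho$ for all $s\in\Sigma$; (E3) $\sigma$ is an optimal policy, i.e. $v_\sigma(x)=v^*(x)$ for all $x\in\mathsf X$.
   Context: $\mathsf X$ and $\mathsf A$ are metric spaces; $b\mathsf X$ is the space of bounded Borel measurable functions $\mathsf X\to\mathbb R$ (supremum norm, pointwise order), $cb\mathsf X$ the continuous ones. A Markov decision process is a tuple $(r,\Gamma,\beta,P)$ where: $\beta\in(0,1)$; $\Gamma$ is a nonempty, compact-valued, continuous correspondence from $\mathsf X$ to $\mathsf A$; with $\mathsf G=\{(x,a): a\in\Gamma(x)\}$, $r:\mathsf G\to\mathbb R$ is bounded and continuous; for each $(x,a)\in\mathsf G$, $P(x,a,\cdot)$ is a Borel probability measure on $\mathsf X$, and $(x,a)\mapsto\int v(x')P(x,a,\mathrm dx')$ is continuous on $\mathsf G$ for every $v\in cb\mathsf X$. $\Sigma$ is the set of Borel measurable $\sigma:\mathsf X\to\mathsf A$ with $\sigma(x)\in\Gamma(x)$ for all $x$. For $\sigma\in\Sigma$, $r_\sigma(x)=r(x,\sigma(x))$,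 $P_\sigma(x,\mathrm dx')=P(x,\sigma(x),\mathrm dx')$ with Markov operator $(P_\sigma f)(x)=\int f(x')P_\sigma(x,\mathrm dx')$, $P_\sigma^n$ the $n$-step kernel, and $v_\sigma=\sum_{t\ge0}(\beta P_\sigma)^t r_\sigma$. The value function is $v^*(x)=\sup_{s\in\Sigma}v_s(x)$; $\sigma$ is optimal if $v_\sigma=v^*$ on $\mathsf X$. For a transition kernel $Q$ on $\mathsf X$, $y$ is $Q$-reachable from $x$ if for every open neighborhood $G$ of $y$ there is $n\in\mathbb N=\{1,2,\dots\}$ with $Q^n(x,G)>0$; $Q$ is open set irreducible if every $y\in\mathsf X$ is $Q$-reachable from every $x\in\mathsf X$. *)

theory Defs
  imports "HOL-Probability.Probability"
begin

definition upper_hemicontinuous :: "('x::topological_space \<Rightarrow> 'a::topological_space set) \<Rightarrow> bool" where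
  "upper_hemicontinuous \<Gamma> \<longleftrightarrow>
     (\<forall>x V. open V \<and> \<Gamma> x \<subseteq> V \<longrightarrow> (\<exists>U. open U \<and> x \<in> U \<and> (\<forall>y\<in>U. \<Gamma> y \<subseteq> V)))"

definition lower_hemicontinuous :: "('x::topological_space \<Rightarrow> 'a::topological_space set) \<Rightarrow> bool" where
  "lower_hemicontinuous \<Gamma> \<longleftrightarrow>
     (\<forall>x V. open V \<and> \<Gamma> x \<inter> V \<noteq> {} \<longrightarrow> (\<exists>U. open U \<and> x \<in> U \<and> (\<forall>y\<in>U. \<Gamma> y \<inter> V \<noteq> {})))"

definition continuous_correspondence :: "('x::topological_space \<Rightarrow> 'a::topological_space set) \<Rightarrow> bool" where
  "continuous_correspondence \<Gamma> \<longleftrightarrow> upper_hemicontinuous \<Gamma> \<and> lower_hemicontinuous \<Gamma>"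

definition graphG :: "('x \<Rightarrow> 'a set) \<Rightarrow> ('x \<times> 'a) set" where
  "graphG \<Gamma> = {(x, a). a \<in> \<Gamma> x}"

definition is_mdp ::
  "('x::metric_space \<Rightarrow> 'a::metric_space \<Rightarrow> real) \<Rightarrow> ('x \<Rightarrow> 'a set) \<Rightarrow> real \<Rightarrow> ('x \<Rightarrow> 'a \<Rightarrow> 'x measure) \<Rightarrow> bool" where
  "is_mdp r \<Gamma> \<beta> P \<longleftrightarrow>
     0 < \<beta> \<and> \<beta> < 1 \<and>
     (\<forall>x. \<Gamma> x \<noteq> {} \<and> compact (\<Gamma> x)) \<and>
     continuous_correspondence \<Gamma> \<and>
     continuous_on (graphG \<Gamma>) (\<lambda>p. r (fst p) (snd p)) \<and>
     bounded ((\<lambda>p. r (fst p) (snd p)) ` graphG \<Gamma>) \<and>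
     (\<forall>x a. a \<in> \<Gamma> x \<longrightarrow> prob_space (P x a) \<and> sets (P x a) = sets borel) \<and>
     (\<forall>v::'x \<Rightarrow> real. continuous_on UNIV v \<and> bounded (range v) \<longrightarrow>
        continuous_on (graphG \<Gamma>) (\<lambda>p. \<integral>y. v y \<partial>(P (fst p) (snd p))))"

definition policies :: "('x::topological_space \<Rightarrow> 'a::topological_space set) \<Rightarrow> ('x \<Rightarrow> 'a) set" where
  "policies \<Gamma> = {\<sigma>. \<sigma> \<in> borel_measurable borel \<and> (\<forall>x. \<sigma> x \<in> \<Gamma> x)}"

definition Pop :: "('x \<Rightarrow> 'a \<Rightarrow> 'x measure) \<Rightarrow> ('x \<Rightarrow> 'a) \<Rightarrow> ('x \<Rightarrow> real) \<Rightarrow> 'x \<Rightarrow> real" where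
  "Pop P \<sigma> f x = (\<integral>y. f y \<partial>(P x (\<sigma> x)))"

definition kpow :: "('x \<Rightarrow> 'a \<Rightarrow> 'x measure) \<Rightarrow> ('x \<Rightarrow> 'a) \<Rightarrow> nat \<Rightarrow> 'x \<Rightarrow> 'x set \<Rightarrow> real" where
  "kpow P \<sigma> n x G = (Pop P \<sigma> ^^ n) (indicator G) x"

definition vpol :: "('x \<Rightarrow> 'a \<Rightarrow> real) \<Rightarrow> real \<Rightarrow> ('x \<Rightarrow> 'a \<Rightarrow> 'x measure) \<Rightarrow> ('x \<Rightarrow> 'a) \<Rightarrow> 'x \<Rightarrow> real" where
  "vpol r \<beta> P \<sigma> x = (\<Sum>t. \<beta> ^ t * (Pop P \<sigma> ^^ t) (\<lambda>y. r y (\<sigma> y)) x)"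

definition vstar :: "('x::topological_space \<Rightarrow> 'a::topological_space \<Rightarrow> real) \<Rightarrow> ('x \<Rightarrow> 'a set) \<Rightarrow> real \<Rightarrow> ('x \<Rightarrow> 'a \<Rightarrow> 'x measure) \<Rightarrow> 'x \<Rightarrow> real" where
  "vstar r \<Gamma> \<beta> P x = (SUP s\<in>policies \<Gamma>. vpol r \<beta> P s x)"

definition optimal_policy where
  "optimal_policy r \<Gamma> \<beta> P \<sigma> \<longleftrightarrow> (\<forall>x. vpol r \<beta> P \<sigma> x = vstar r \<Gamma> \<beta> P x)"

section \<open>Reachability for a kernel given by its n-step probabilities Qn n x G = Q^n(x,G)\<close>

definition reachable :: "(nat \<Rightarrow> 'x::topological_space \<Rightarrow> 'x set \<Rightarrow> real) \<Rightarrow> 'x \<Rightarrow> 'x \<Rightarrow> bool" where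
  "reachable Qn x y \<longleftrightarrow> (\<forall>G. open G \<and> y \<in> G \<longrightarrow> (\<exists>n\<ge>1. Qn n x G > 0))"

definition open_set_irreducible :: "(nat \<Rightarrow> 'x::topological_space \<Rightarrow> 'x set \<Rightarrow> real) \<Rightarrow> bool" where
  "open_set_irreducible Qn \<longleftrightarrow> (\<forall>x y. reachable Qn x y)"

end

theory Submission
  imports Defs
begin

text \<open>Only E2 implies E3 is substantial. Since \<open>\<sigma>\<close> is continuous, \<open>v\<^sub>\<sigma>\<close> is continuous, so if the
  Bellman inequality for \<open>v\<^sub>\<sigma>\<close> failed at some feasible pair, lower hemicontinuity and a measurable
  selection would give a policy \<open>s\<close> that equals \<open>\<sigma>\<close> off an open set \<open>U\<close> and strictly improves on
  \<open>v\<^sub>\<sigma>\<close> in one step on \<open>U\<close>. As every state reaches \<open>U\<close> under \<open>\<sigma>\<close>, this yields \<open>v\<^sub>s > v\<^sub>\<sigma>\<close>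
  everywhere, contradicting E2 for every \<open>\<rho>\<close>. So the Bellman inequality holds, and it makes \<open>\<sigma>\<close>
  optimal.

  The spaces are not assumed separable, which endangers the measurability of \<open>x \<mapsto> P(x, s(x), \<cdot>)\<close>
  for a merely measurable \<open>s\<close>. But irreducibility gives every ball positive mass under some
  \<open>n\<close>-step kernel from a fixed state, so separated sets are countable and the state space is
  separable.\<close>

section \<open>Markov kernels\<close>

text \<open>Open sets form an intersection-stable generator of the Borel sets, so measurability of
  the mass of each open set suffices. The indicator of an open set is the pointwise limit of bounded
  continuous functions, and dominated convergence carries measurability over. This fits the Feller
  property, which speaks of bounded continuous functions only.\<close>

lemma measurable_prob_algebra_continuousI:
  fixes K :: "'b \<Rightarrow> 'x::metric_space measure"
  assumes prob: "\<And>x. x \<in> space M \<Longrightarrow> prob_space (K x)"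
    and sets_K: "\<And>x. x \<in> space M \<Longrightarrow> sets (K x) = sets borel"
    and integral: "\<And>f::'x \<Rightarrow> real. continuous_on UNIV f \<Longrightarrow> bounded (range f) \<Longrightarrow>
      (\<lambda>x. \<integral>y. f y \<partial>K x) \<in> borel_measurable M"
  shows "K \<in> M \<rightarrow>\<^sub>M prob_algebra borel"
proof (rule measurable_prob_algebra_generated[where \<Omega> = UNIV and G = "{S. open S}"])
  show "sets borel = sigma_sets UNIV {S::'x set. open S}"
    by (simp add: borel_def)
  show "Int_stable {S::'x set. open S}"
    by (auto simp: Int_stable_def)
  fix U :: "'x set" assume "U \<in> {S. open S}"
  then have U: "open U" by simp
  show "(\<lambda>x. emeasure (K x) U) \<in> borel_measurable M"
  proof (cases "U = UNIV")
    case True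
    have "emeasure (K x) U = 1" if "x \<in> space M" for x
      using prob_space.emeasure_space_1[OF prob[OF that]] sets_eq_imp_space_eq[OF sets_K[OF that]] True
      by simp
    then show ?thesis
      by (subst measurable_cong[where g = "\<lambda>_. 1"]) auto
  next
    case False
    \<comment> \<open>The case split is forced by the convention that \<open>infdist\<close> to the
      empty set is 0: for \<open>U = UNIV\<close> these functions would all vanish.\<close>
    define f where "f n y = min 1 (real n * infdist y (- U))" for n y
    have f_cont: "continuous_on UNIV (f n)" for n
      unfolding f_def by (intro continuous_intros)
    have f_bound: "\<bar>f n y\<bar> \<le> 1" for n y
      using infdist_nonneg[of y "- U"] by (auto simp: f_def abs_le_iff)
    have f_bdd: "bounded (range (f n))" for n
      using f_bound by (auto simp: bounded_iff)
    have f_lim: "(\<lambda>n. f n y) \<longlonglongrightarrow> indicator U y" for y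
    proof (cases "y \<in> U")
      case True
      then have "infdist y (- U) > 0"
        using infdist_pos_not_in_closed[of "- U" y] U False by auto
      then obtain N where N: "1 < real N * infdist y (- U)"
        using reals_Archimedean3 by blast
      have "f n y = 1" if "n \<ge> N" for n
        using N mult_right_mono[of "real N" "real n" "infdist y (- U)"] that infdist_nonneg[of y "- U"]
        by (auto simp: f_def)
      then have "eventually (\<lambda>n. f n y = 1) sequentially"
        by (auto simp: eventually_sequentially)
      then show ?thesis
        using True by (simp add: tendsto_eventually)
    next
      case False
      then have "infdist y (- U) = 0"
        by simp
      then show ?thesis
        using False by (simp add: f_def)
    qed
    have "(\<lambda>n. \<integral>y. f n y \<partial>K x) \<longlonglongrightarrow> measure (K x) U" if x: "x \<in> space M" for x
    proof -
      interpret prob_space "K x" by (rule prob[OF x])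
      note [measurable_cong] = sets_K[OF x]
      have [measurable]: "f n \<in> borel_measurable (K x)" for n
        using borel_measurable_continuous_onI[OF f_cont] by measurable
      have [measurable]: "U \<in> sets (K x)"
        using U sets_K[OF x] by simp
      have "(\<lambda>n. \<integral>y. f n y \<partial>K x) \<longlonglongrightarrow> (\<integral>y. indicator U y \<partial>K x)"
        by (rule integral_dominated_convergence[where w = "\<lambda>_. 1"]) (use f_lim f_bound in auto)
      then show ?thesis by simp
    qed
    then have m: "(\<lambda>x. measure (K x) U) \<in> borel_measurable M"
      by (rule borel_measurable_LIMSEQ_real) (use integral[OF f_cont f_bdd] in auto)
    have "emeasure (K x) U = ennreal (measure (K x) U)" if "x \<in> space M" for x
    proof -
      interpret prob_space "K x" by (rule prob[OF that])
      show ?thesis by (rule emeasure_eq_measure)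
    qed
    then show ?thesis
      using m by (subst measurable_cong[where g = "\<lambda>x. ennreal (measure (K x) U)"]) auto
  qed
qed (use prob sets_K in auto)

section \<open>The Markov operator of a fixed policy\<close>

locale markov_policy =
  fixes P :: "'x::metric_space \<Rightarrow> 'a \<Rightarrow> 'x measure" and s :: "'x \<Rightarrow> 'a"
  assumes kernel: "(\<lambda>x. P x (s x)) \<in> borel \<rightarrow>\<^sub>M prob_algebra borel"
begin

lemma prob_space_kernel: "prob_space (P x (s x))"
  and sets_kernel: "sets (P x (s x)) = sets borel"
  using measurable_space[OF kernel, of x] by (auto simp: space_prob_algebra)

lemma integrable_kernel:
  assumes "f \<in> borel_measurable borel" and "\<And>y. \<bar>f y\<bar> \<le> (C::real)"
  shows "integrable (P x (s x)) f"
proof -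
  interpret prob_space "P x (s x)" by (rule prob_space_kernel)
  show ?thesis
    by (rule integrable_const_bound[where B = C])
      (use assms measurable_cong_sets[OF sets_kernel refl] in auto)
qed

lemma Pop_measurable:
  assumes "f \<in> borel_measurable borel"
  shows "Pop P s f \<in> borel_measurable borel"
  unfolding Pop_def[abs_def]
  by (rule measurable_compose[OF measurable_prob_algebraD[OF kernel]
        integral_measurable_subprob_algebra[OF assms]])

lemma Pop_ge:
  assumes "f \<in> borel_measurable borel" and "\<And>y. \<bar>f y\<bar> \<le> C" and "\<And>y. c \<le> f y"
  shows "c \<le> Pop P s f x"
proof -
  interpret prob_space "P x (s x)" by (rule prob_space_kernel)
  show ?thesis
    unfolding Pop_def by (rule integral_ge_const[OF integrable_kernel[OF assms(1,2)]]) (use assms in auto)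
qed

lemma Pop_abs_le:
  assumes "f \<in> borel_measurable borel" and "\<And>y. \<bar>f y\<bar> \<le> C"
  shows "\<bar>Pop P s f x\<bar> \<le> C"
proof -
  interpret prob_space "P x (s x)" by (rule prob_space_kernel)
  have "Pop P s f x \<le> C"
    unfolding Pop_def
    by (rule integral_le_const[OF integrable_kernel[OF assms]]) (use assms in \<open>auto simp: abs_le_iff\<close>)
  moreover have "- C \<le> Pop P s f x"
    by (rule Pop_ge[OF assms]) (use assms in \<open>auto simp: abs_le_iff minus_le_iff\<close>)
  ultimately show ?thesis by (simp add: abs_le_iff)
qed

lemma Pop_diff:
  assumes "f \<in> borel_measurable borel" and "\<And>y. \<bar>f y\<bar> \<le> C"
    and "g \<in> borel_measurable borel" and "\<And>y. \<bar>g y\<bar> \<le> C'"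
  shows "Pop P s (\<lambda>y. f y - g y) x = Pop P s f x - Pop P s g x"
  unfolding Pop_def by (rule Bochner_Integration.integral_diff) (auto intro!: integrable_kernel assms)

lemma funpow_Pop:
  assumes "f \<in> borel_measurable borel" and "\<And>y. \<bar>f y\<bar> \<le> C"
  shows funpow_Pop_measurable: "(Pop P s ^^ n) f \<in> borel_measurable borel"
    and funpow_Pop_abs_le: "\<bar>(Pop P s ^^ n) f x\<bar> \<le> C"
proof -
  have "(Pop P s ^^ n) f \<in> borel_measurable borel \<and> (\<forall>x. \<bar>(Pop P s ^^ n) f x\<bar> \<le> C)"
    using assms by (induction n) (auto intro: Pop_measurable Pop_abs_le)
  then show "(Pop P s ^^ n) f \<in> borel_measurable borel" "\<bar>(Pop P s ^^ n) f x\<bar> \<le> C"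
    by auto
qed

lemma funpow_Pop_sum:
  assumes "finite I" and "\<And>i. i \<in> I \<Longrightarrow> f i \<in> borel_measurable borel"
    and "\<And>i y. i \<in> I \<Longrightarrow> \<bar>f i y\<bar> \<le> C"
  shows "(Pop P s ^^ n) (\<lambda>y. \<Sum>i\<in>I. f i y) x = (\<Sum>i\<in>I. (Pop P s ^^ n) (f i) x)"
proof (induction n arbitrary: x)
  case (Suc n)
  have "(Pop P s ^^ Suc n) (\<lambda>y. \<Sum>i\<in>I. f i y) x = Pop P s (\<lambda>y. \<Sum>i\<in>I. (Pop P s ^^ n) (f i) y) x"
    by (simp add: ext[OF Suc])
  also have "\<dots> = (\<Sum>i\<in>I. (Pop P s ^^ Suc n) (f i) x)"
    unfolding Pop_def funpow.simps o_def
    by (rule Bochner_Integration.integral_sum)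
      (auto simp flip: Pop_def intro!: integrable_kernel[where C = C] funpow_Pop_measurable funpow_Pop_abs_le assms)
  finally show ?case .
qed simp

text \<open>\<open>kpow\<close> iterates an operator on indicators and is not given as a measure.
  Linearity replaces additivity: the sum is the iterate applied to the indicator of the disjoint
  union, which is bounded by 1.\<close>

lemma sum_kpow_le_1:
  assumes "finite I" and "disjoint_family_on G I" and "\<And>i. i \<in> I \<Longrightarrow> G i \<in> sets borel"
  shows "(\<Sum>i\<in>I. kpow P s n x (G i)) \<le> 1"
proof -
  have "(\<Sum>i\<in>I. kpow P s n x (G i)) = (Pop P s ^^ n) (\<lambda>y. \<Sum>i\<in>I. indicator (G i) y) x"
    unfolding kpow_def
    by (rule funpow_Pop_sum[symmetric, where C = 1]) (use assms in \<open>auto simp: indicator_def\<close>)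
  also have "(\<lambda>y. \<Sum>i\<in>I. indicator (G i) y) = (indicator (\<Union>i\<in>I. G i) :: 'x \<Rightarrow> real)"
    by (rule ext) (simp add: indicator_UN_disjoint[OF assms(1,2)])
  also have "\<bar>(Pop P s ^^ n) (indicator (\<Union>i\<in>I. G i)) x\<bar> \<le> 1"
    by (rule funpow_Pop_abs_le) (use assms in \<open>auto simp: indicator_def\<close>)
  finally show ?thesis by linarith
qed

lemma kpow_nonneg: "0 \<le> kpow P s n x G"
proof -
  have "\<forall>x. 0 \<le> (Pop P s ^^ n) (indicator G) x"
    by (induction n) (auto simp: Pop_def intro!: integral_nonneg_AE)
  then show ?thesis by (simp add: kpow_def)
qed

text \<open>A minimum principle. If \<open>m\<close> is the infimum of \<open>w\<close>, averaging
  cannot go below \<open>m\<close>, so the hypothesis gives \<open>w \<ge> \<beta> * m\<close>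
  everywhere. Hence \<open>m \<ge> \<beta> * m\<close>, and \<open>\<beta> < 1\<close> forces
  \<open>m \<ge> 0\<close>.\<close>

lemma comparison:
  assumes w: "w \<in> borel_measurable borel" and bound: "\<And>y. \<bar>w y\<bar> \<le> C"
    and "0 \<le> \<beta>" "\<beta> < 1" and super: "\<And>x. \<beta> * Pop P s w x \<le> w x"
  shows "0 \<le> w x"
proof -
  define m where "m = (INF y. w y)"
  have bdd: "bdd_below (range w)"
    using bound by (intro bdd_belowI[of _ "- C"]) (auto simp: abs_le_iff minus_le_iff)
  have m: "m \<le> w y" for y
    unfolding m_def using bdd by (auto intro: cINF_lower)
  have "\<beta> * m \<le> w y" for y
    using mult_left_mono[OF Pop_ge[OF w bound m], of \<beta> y] super[of y] \<open>0 \<le> \<beta>\<close> by linarith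
  then have "\<beta> * m \<le> m"
    unfolding m_def by (intro cINF_greatest) auto
  then have "0 \<le> (1 - \<beta>) * m" by (simp add: algebra_simps)
  then have "0 \<le> m" using \<open>\<beta> < 1\<close> by (simp add: zero_le_mult_iff)
  then show ?thesis using m[of x] by linarith
qed

end

section \<open>Discounted values: evaluation equation, comparison and continuity\<close>

locale discounted_policy = markov_policy P s
  for P :: "'x::metric_space \<Rightarrow> 'a \<Rightarrow> 'x measure" and s :: "'x \<Rightarrow> 'a" +
  fixes r :: "'x \<Rightarrow> 'a \<Rightarrow> real" and \<beta> C :: real
  assumes \<beta>: "0 < \<beta>" "\<beta> < 1"
    and reward_measurable: "(\<lambda>y. r y (s y)) \<in> borel_measurable borel"
    and reward_bound: "\<And>y. \<bar>r y (s y)\<bar> \<le> C"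
begin

lemma vpol_term_bound: "\<bar>\<beta> ^ t * (Pop P s ^^ t) (\<lambda>y. r y (s y)) x\<bar> \<le> \<beta> ^ t * C"
  using funpow_Pop_abs_le[OF reward_measurable reward_bound, of t x] \<beta>
  by (simp add: abs_mult mult_left_mono)

lemma summable_geometric_bound: "summable (\<lambda>t. \<beta> ^ t * C)"
  using \<beta> by (intro summable_mult2 summable_geometric) auto

lemma vpol_summable: "summable (\<lambda>t. \<beta> ^ t * (Pop P s ^^ t) (\<lambda>y. r y (s y)) x)"
  by (rule summable_comparison_test'[OF summable_geometric_bound, of 0]) (use vpol_term_bound in auto)

lemma vpol_measurable: "vpol r \<beta> P s \<in> borel_measurable borel"
  unfolding vpol_def[abs_def]
  by (intro borel_measurable_suminf borel_measurable_times borel_measurable_const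
      funpow_Pop_measurable[OF reward_measurable reward_bound])

lemma vpol_abs_le: "\<bar>vpol r \<beta> P s x\<bar> \<le> C / (1 - \<beta>)"
proof -
  have "\<bar>vpol r \<beta> P s x\<bar> \<le> (\<Sum>t. \<beta> ^ t * C)"
    unfolding vpol_def
    using norm_suminf_le[OF _ summable_geometric_bound, of "\<lambda>t. \<beta> ^ t * (Pop P s ^^ t) (\<lambda>y. r y (s y)) x"]
      vpol_term_bound by simp
  also have "\<dots> = C / (1 - \<beta>)"
    using \<beta> suminf_mult2[of "\<lambda>t. \<beta> ^ t" C] by (simp add: suminf_geometric summable_geometric)
  finally show ?thesis .
qed

text \<open>The geometric bound on the terms permits exchanging the integral with the series.
  Multiplying by \<open>\<beta>\<close> then shifts the series by one index, and only its head, the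
  current reward, is missing.\<close>

lemma vpol_fixpoint: "vpol r \<beta> P s x = r x (s x) + \<beta> * Pop P s (vpol r \<beta> P s) x"
proof -
  interpret prob_space "P x (s x)" by (rule prob_space_kernel)
  let ?f = "\<lambda>t y. \<beta> ^ t * (Pop P s ^^ t) (\<lambda>y. r y (s y)) y"
  have int: "integrable (P x (s x)) (?f t)" for t
    by (rule integrable_kernel[where C = "\<beta> ^ t * C"])
      (auto intro!: vpol_term_bound borel_measurable_times
        funpow_Pop_measurable[OF reward_measurable reward_bound])
  have abs_le: "(\<integral>y. \<bar>?f t y\<bar> \<partial>P x (s x)) \<le> \<beta> ^ t * C" for t
    by (rule integral_le_const) (use int vpol_term_bound in auto)
  have "Pop P s (vpol r \<beta> P s) x = (\<integral>y. (\<Sum>t. ?f t y) \<partial>P x (s x))"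
    by (simp add: Pop_def vpol_def)
  also have "\<dots> = (\<Sum>t. \<integral>y. ?f t y \<partial>P x (s x))"
  proof (rule integral_suminf)
    show "AE y in P x (s x). summable (\<lambda>t. norm (?f t y))"
      by (intro AE_I2 summable_comparison_test'[OF summable_geometric_bound, of 0])
        (use vpol_term_bound in auto)
    show "summable (\<lambda>t. \<integral>y. norm (?f t y) \<partial>P x (s x))"
      by (rule summable_comparison_test'[OF summable_geometric_bound, of 0]) (use abs_le in auto)
  qed (rule int)
  also have "\<dots> = (\<Sum>t. \<beta> ^ t * (Pop P s ^^ Suc t) (\<lambda>y. r y (s y)) x)"
    by (simp add: Pop_def)
  finally have "\<beta> * Pop P s (vpol r \<beta> P s) x = \<beta> * (\<Sum>t. \<beta> ^ t * (Pop P s ^^ Suc t) (\<lambda>y. r y (s y)) x)"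
    by simp
  also have "\<dots> = (\<Sum>t. \<beta> ^ Suc t * (Pop P s ^^ Suc t) (\<lambda>y. r y (s y)) x)"
  proof -
    have "summable (\<lambda>t. \<beta> ^ Suc t * (Pop P s ^^ Suc t) (\<lambda>y. r y (s y)) x)"
      using vpol_summable[of x] by (subst summable_Suc_iff)
    then have "summable (\<lambda>t. \<beta> ^ t * (Pop P s ^^ Suc t) (\<lambda>y. r y (s y)) x)"
      using \<beta> summable_mult_D[of \<beta> "\<lambda>t. \<beta> ^ t * (Pop P s ^^ Suc t) (\<lambda>y. r y (s y)) x"]
      by (simp add: mult.assoc)
    from suminf_mult[OF this, of \<beta>] show ?thesis by (simp add: mult.assoc)
  qed
  also have "\<dots> = vpol r \<beta> P s x - r x (s x)"
    using suminf_split_head[OF vpol_summable[of x]] by (simp add: vpol_def)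
  finally show ?thesis by simp
qed

text \<open>By the fixed point equation, the difference \<open>u - vpol r \<beta> P s\<close>
  satisfies the hypothesis of \<open>comparison\<close>. With \<open>u\<close> the value of another
  policy, this turns the Bellman inequality into optimality.\<close>

lemma vpol_le:
  assumes u: "u \<in> borel_measurable borel" and bound: "\<And>y. \<bar>u y\<bar> \<le> D"
    and super: "\<And>x. r x (s x) + \<beta> * Pop P s u x \<le> u x"
  shows "vpol r \<beta> P s x \<le> u x"
proof -
  have "0 \<le> u x - vpol r \<beta> P s x"
  proof (rule comparison[where \<beta> = \<beta> and C = "D + C / (1 - \<beta>)"])
    show "(\<lambda>y. u y - vpol r \<beta> P s y) \<in> borel_measurable borel"
      using u vpol_measurable by simp
    show "\<bar>u y - vpol r \<beta> P s y\<bar> \<le> D + C / (1 - \<beta>)" for y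
      using bound[of y] vpol_abs_le[of y] by linarith
    show "\<beta> * Pop P s (\<lambda>y. u y - vpol r \<beta> P s y) y \<le> u y - vpol r \<beta> P s y" for y
      using super[of y] vpol_fixpoint[of y] Pop_diff[OF u bound vpol_measurable vpol_abs_le, of y]
      by (simp add: right_diff_distrib)
  qed (use \<beta> in auto)
  then show ?thesis by simp
qed

text \<open>The mirror image of \<open>vpol_le\<close>. It shows that a policy which is nowhere
  worse in one step is nowhere worse in total value.\<close>

lemma vpol_ge:
  assumes u: "u \<in> borel_measurable borel" and bound: "\<And>y. \<bar>u y\<bar> \<le> D"
    and sub: "\<And>x. u x \<le> r x (s x) + \<beta> * Pop P s u x"
  shows "u x \<le> vpol r \<beta> P s x"
proof -
  have "0 \<le> vpol r \<beta> P s x - u x"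
  proof (rule comparison[where \<beta> = \<beta> and C = "D + C / (1 - \<beta>)"])
    show "(\<lambda>y. vpol r \<beta> P s y - u y) \<in> borel_measurable borel"
      using u vpol_measurable by simp
    show "\<bar>vpol r \<beta> P s y - u y\<bar> \<le> D + C / (1 - \<beta>)" for y
      using bound[of y] vpol_abs_le[of y] by linarith
    show "\<beta> * Pop P s (\<lambda>y. vpol r \<beta> P s y - u y) y \<le> vpol r \<beta> P s y - u y" for y
      using sub[of y] vpol_fixpoint[of y] Pop_diff[OF vpol_measurable vpol_abs_le u bound, of y]
      by (simp add: right_diff_distrib)
  qed (use \<beta> in auto)
  then show ?thesis by simp
qed

text \<open>The Feller property makes each term of the series continuous, and the Weierstrass test
  with the geometric bound makes the convergence uniform.\<close>

lemma continuous_on_vpol: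
  assumes feller: "\<And>f. continuous_on UNIV f \<Longrightarrow> bounded (range f) \<Longrightarrow> continuous_on UNIV (Pop P s f)"
    and reward: "continuous_on UNIV (\<lambda>y. r y (s y))"
  shows "continuous_on UNIV (vpol r \<beta> P s)"
proof -
  have term_cont: "continuous_on UNIV ((Pop P s ^^ t) (\<lambda>y. r y (s y)))" for t
  proof (induction t)
    case (Suc t)
    have "bounded (range ((Pop P s ^^ t) (\<lambda>y. r y (s y))))"
      using funpow_Pop_abs_le[OF reward_measurable reward_bound] by (auto simp: bounded_iff)
    with Suc show ?case by (simp add: feller)
  qed (use reward in simp)
  have "uniform_limit UNIV (\<lambda>n x. \<Sum>t<n. \<beta> ^ t * (Pop P s ^^ t) (\<lambda>y. r y (s y)) x)
      (vpol r \<beta> P s) sequentially"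
    unfolding vpol_def[abs_def]
    by (rule Weierstrass_m_test_ev[OF _ summable_geometric_bound]) (use vpol_term_bound in auto)
  then show ?thesis
    by (rule uniform_limit_theorem[rotated])
      (simp_all add: continuous_on_sum continuous_on_mult_left term_cont)
qed

end

section \<open>Measurable selection\<close>

text \<open>Being a minimiser refers to uncountably many competitors. Compactness allows a countable
  test instead: some minimiser lies in \<open>C\<close> iff \<open>F x\<close> meets
  \<open>C\<close> and, for every rational radius, a closed ball around \<open>a\<close> that meets
  \<open>F x\<close> also meets it inside \<open>C\<close>.\<close>

lemma compact_argmin_measurable:
  fixes F :: "'x \<Rightarrow> 'a::metric_space set"
  assumes comp: "\<And>x. x \<in> space M \<Longrightarrow> compact (F x)"
    and hit: "\<And>C. closed C \<Longrightarrow> {x \<in> space M. F x \<inter> C \<noteq> {}} \<in> sets M"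
    and "closed C"
  shows "{x \<in> space M. {y \<in> F x. \<forall>z\<in>F x. dist a y \<le> dist a z} \<inter> C \<noteq> {}} \<in> sets M"
proof -
  have iff: "{y \<in> F x. \<forall>z\<in>F x. dist a y \<le> dist a z} \<inter> C \<noteq> {} \<longleftrightarrow> F x \<inter> C \<noteq> {} \<and>
      (\<forall>q::rat. F x \<inter> cball a (of_rat q) \<noteq> {} \<longrightarrow> F x \<inter> (C \<inter> cball a (of_rat q)) \<noteq> {})"
    (is "?L \<longleftrightarrow> ?R") if x: "x \<in> space M" for x
  proof
    assume ?L
    then obtain y where y: "y \<in> F x" "y \<in> C" and min: "\<And>z. z \<in> F x \<Longrightarrow> dist a y \<le> dist a z" by blast
    have "y \<in> F x \<inter> (C \<inter> cball a (of_rat q))" if "F x \<inter> cball a (of_rat q) \<noteq> {}" for q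
    proof -
      from that obtain z where "z \<in> F x" "dist a z \<le> of_rat q" by auto
      with min[of z] y show ?thesis by auto
    qed
    with y show ?R by blast
  next
    assume R: ?R
    \<comment> \<open>The candidate is a point of \<open>F x \<inter> C\<close> nearest to
      \<open>a\<close>. A closer point of \<open>F x\<close> would leave room for a rational radius
      at which the countable test fails.\<close>
    have "\<exists>y\<in>F x \<inter> C. \<forall>z\<in>F x \<inter> C. dist a y \<le> dist a z"
      by (rule continuous_attains_inf)
        (use R comp[OF x] \<open>closed C\<close> in \<open>auto intro!: continuous_intros compact_Int_closed\<close>)
    then obtain y where y: "y \<in> F x" "y \<in> C" and min: "\<And>z. z \<in> F x \<Longrightarrow> z \<in> C \<Longrightarrow> dist a y \<le> dist a z"
      by blast
    have "dist a y \<le> dist a z" if z: "z \<in> F x" for z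
    proof (rule ccontr)
      assume "\<not> dist a y \<le> dist a z"
      then obtain q where q: "dist a z < of_rat q" "of_rat q < dist a y"
        using of_rat_dense[of "dist a z" "dist a y"] by auto
      then have "F x \<inter> cball a (of_rat q) \<noteq> {}" using z by force
      then have "F x \<inter> (C \<inter> cball a (of_rat q)) \<noteq> {}" using R by blast
      then obtain u where "u \<in> F x" "u \<in> C" "dist a u \<le> of_rat q" by auto
      with min[of u] q show False by linarith
    qed
    with y show ?L by blast
  qed
  have "{x \<in> space M. F x \<inter> C \<noteq> {} \<and>
      (\<forall>q::rat. F x \<inter> cball a (of_rat q) \<noteq> {} \<longrightarrow> F x \<inter> (C \<inter> cball a (of_rat q)) \<noteq> {})} \<in> sets M"
    by (intro sets.sets_Collect_conj sets.sets_Collect_countable_All sets.sets_Collect_imp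
        hit closed_Int closed_cball \<open>closed C\<close>)
  then show ?thesis
    using iff by (simp cong: conj_cong)
qed

text \<open>Lexicographic minimisation: stage \<open>n\<close> minimises the distances to
  \<open>a 0\<close>, ..., \<open>a (n - 1)\<close> in this order of priority.\<close>

primrec argmin_chain :: "('x \<Rightarrow> 'a::metric_space set) \<Rightarrow> (nat \<Rightarrow> 'a) \<Rightarrow> nat \<Rightarrow> 'x \<Rightarrow> 'a set" where
  "argmin_chain F a 0 x = F x"
| "argmin_chain F a (Suc n) x =
     {y \<in> argmin_chain F a n x. \<forall>z\<in>argmin_chain F a n x. dist (a n) y \<le> dist (a n) z}"

lemma compact_decseq_Int_nonempty:
  fixes F :: "nat \<Rightarrow> 'a::t2_space set"
  assumes "\<And>n. compact (F n)" and "\<And>n. F n \<noteq> {}" and "decseq F"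
  shows "(\<Inter>n. F n) \<noteq> {}"
proof -
  have "F 0 \<inter> (\<Inter>n\<in>UNIV. F n) \<noteq> {}"
  proof (rule compact_imp_fip_image)
    fix I :: "nat set" assume "finite I"
    \<comment> \<open>Inserting 0 makes the maximum meaningful for empty \<open>I\<close>.\<close>
    then have "F (Max (insert 0 I)) \<subseteq> F 0 \<inter> (\<Inter>n\<in>I. F n)"
      by (intro Int_greatest INF_greatest decseqD[OF \<open>decseq F\<close>]) auto
    then show "F 0 \<inter> (\<Inter>n\<in>I. F n) \<noteq> {}" using assms(2) by blast
  qed (use assms in \<open>auto intro: compact_imp_closed\<close>)
  then show ?thesis by blast
qed

text \<open>Minimising the distances to a dense sequence one after the other shrinks a compact set to a
  single point, and every stage of this process stays measurable.\<close>

lemma compact_valued_measurable_selection: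
  fixes F :: "'x \<Rightarrow> 'a::metric_space set"
  assumes comp: "\<And>x. x \<in> space M \<Longrightarrow> compact (F x)"
    and ne: "\<And>x. x \<in> space M \<Longrightarrow> F x \<noteq> {}"
    and hit: "\<And>C. closed C \<Longrightarrow> {x \<in> space M. F x \<inter> C \<noteq> {}} \<in> sets M"
    and "countable D" and dense: "\<And>x y e. x \<in> space M \<Longrightarrow> y \<in> F x \<Longrightarrow> 0 < e \<Longrightarrow> \<exists>d\<in>D. dist d y < e"
  obtains s where "s \<in> borel_measurable M" and "\<And>x. x \<in> space M \<Longrightarrow> s x \<in> F x"
proof -
  define a where "a = from_nat_into D"
  define G where "G = argmin_chain F a"
  have G_Suc: "G (Suc n) x = {y \<in> G n x. \<forall>z\<in>G n x. dist (a n) y \<le> dist (a n) z}" for n x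
    by (simp add: G_def)
  \<comment> \<open>Measurability and compactness go through one induction, since the measurability
    step for stage \<open>Suc n\<close> requires stage \<open>n\<close> to be compact.\<close>
  have G_hit: "{x \<in> space M. G n x \<inter> C \<noteq> {}} \<in> sets M \<and> (\<forall>x\<in>space M. compact (G n x) \<and> G n x \<noteq> {})"
    if "closed C" for n C
    using that
  proof (induction n arbitrary: C)
    case 0
    then show ?case using hit comp ne by (simp add: G_def)
  next
    case (Suc n)
    have comp_n: "compact (G n x)" and ne_n: "G n x \<noteq> {}" if "x \<in> space M" for x
      using Suc.IH[OF Suc.prems] that by auto
    have "compact (G (Suc n) x) \<and> G (Suc n) x \<noteq> {}" if x: "x \<in> space M" for x
    proof
      have "\<exists>y\<in>G n x. \<forall>z\<in>G n x. dist (a n) y \<le> dist (a n) z"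
        by (rule continuous_attains_inf) (use comp_n[OF x] ne_n[OF x] in \<open>auto intro!: continuous_intros\<close>)
      then show "G (Suc n) x \<noteq> {}" unfolding G_Suc by blast
      have "G (Suc n) x = G n x \<inter> (\<Inter>z\<in>G n x. cball (a n) (dist (a n) z))"
        unfolding G_Suc by auto
      then show "compact (G (Suc n) x)"
        using comp_n[OF x] by (auto intro!: compact_Int_closed)
    qed
    moreover have "{x \<in> space M. G (Suc n) x \<inter> C \<noteq> {}} \<in> sets M"
      unfolding G_Suc by (rule compact_argmin_measurable) (use Suc comp_n in auto)
    ultimately show ?case by blast
  qed
  have G_comp: "compact (G n x)" and G_ne: "G n x \<noteq> {}" if "x \<in> space M" for n x
    using G_hit[of "{}" n] that by auto
  have G_dec: "decseq (\<lambda>n. G n x)" for x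
    by (rule decseq_SucI) (auto simp: G_Suc)
  \<comment> \<open>Two points that survive every stage minimise against each other, so they have
    equal distances to every \<open>a n\<close>. An element of \<open>D\<close> closer to
    \<open>y\<close> than half of \<open>dist y z\<close> would then be equally close to
    \<open>z\<close>, against the triangle inequality.\<close>
  have G_unique: "y = z" if x: "x \<in> space M" and y: "\<And>n. y \<in> G n x" and z: "\<And>n. z \<in> G n x" for x y z
  proof (rule ccontr)
    assume "y \<noteq> z"
    moreover have "y \<in> F x" using y[of 0] by (simp add: G_def)
    ultimately obtain d where d: "d \<in> D" "dist d y < dist y z / 2"
      using dense[OF x, of y "dist y z / 2"] by auto
    then obtain n where n: "d = a n"
      using from_nat_into_surj[OF \<open>countable D\<close>, of d] by (auto simp: a_def)
    have "dist d y = dist d z"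
      using y[of "Suc n"] z[of "Suc n"] y[of n] z[of n] by (force simp: G_Suc n)
    with d dist_triangle2[of y z d] show False by (simp add: dist_commute)
  qed
  define s where "s x = (SOME y. \<forall>n. y \<in> G n x)" for x
  have s: "s x \<in> G n x" if x: "x \<in> space M" for n x
  proof -
    have "(\<Inter>n. G n x) \<noteq> {}"
      by (rule compact_decseq_Int_nonempty[OF G_comp[OF x] G_ne[OF x] G_dec])
    then have "\<exists>y. \<forall>n. y \<in> G n x" by blast
    from someI_ex[OF this] show ?thesis by (simp add: s_def)
  qed
  \<comment> \<open>The stages shrink to the single point \<open>s x\<close>. If each of them meets
    the closed set \<open>C\<close>, compactness yields a common point in \<open>C\<close>, and
    uniqueness identifies it with \<open>s x\<close>. Preimages of closed sets thus become countable
    intersections of measurable sets.\<close>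
  have vimage: "s x \<in> C \<longleftrightarrow> (\<forall>n. G n x \<inter> C \<noteq> {})" if x: "x \<in> space M" and C: "closed C" for x C
  proof
    assume "\<forall>n. G n x \<inter> C \<noteq> {}"
    then have "(\<Inter>n. G n x \<inter> C) \<noteq> {}"
      using G_comp[OF x] C
      by (intro compact_decseq_Int_nonempty decseq_SucI) (auto intro!: compact_Int_closed simp: G_Suc)
    then obtain y where "\<And>n. y \<in> G n x" "y \<in> C" by auto
    with G_unique[OF x, of "s x" y] s[OF x] show "s x \<in> C" by simp
  qed (use s[OF x] in auto)
  show thesis
  proof
    show "s x \<in> F x" if "x \<in> space M" for x
      using s[OF that, of 0] by (simp add: G_def)
    have "{x \<in> space M. s x \<in> C} \<in> sets M" if C: "closed C" for C
    proof -
      have "{x \<in> space M. s x \<in> C} = {x \<in> space M. \<forall>n. G n x \<inter> C \<noteq> {}}"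
        using vimage[OF _ C] by auto
      also have "\<dots> \<in> sets M"
        using G_hit[OF C] by (intro sets.sets_Collect_countable_All) auto
      finally show ?thesis .
    qed
    then show "s \<in> borel_measurable M"
      unfolding borel_eq_closed by (intro measurable_measure_of) (auto simp: vimage_def Int_def conj_commute)
  qed
qed

section \<open>Separability\<close>

text \<open>Zorn's lemma gives a maximal \<open>e\<close>-separated set, and maximality makes it an
  \<open>e\<close>-net. The balls of radius \<open>e / 2\<close> around its points are disjoint and
  each has positive mass under some \<open>n\<close>-step kernel. For fixed \<open>n\<close> the
  masses sum to at most 1, so only countably many are nonzero. The union of the nets for
  \<open>e = 1 / Suc n\<close> is dense.\<close>

lemma (in markov_policy) irreducible_imp_separable:
  assumes irr: "open_set_irreducible (kpow P s)"
  obtains D :: "'x set" where "countable D" and "\<And>x e. 0 < e \<Longrightarrow> \<exists>d\<in>D. dist d x < e"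
proof -
  have net: "\<exists>S::'x set. countable S \<and> (\<forall>x. \<exists>d\<in>S. dist d x < e)" if e: "0 < e" for e
  proof -
    define \<A> :: "'x set set" where "\<A> = {S. \<forall>x\<in>S. \<forall>y\<in>S. x \<noteq> y \<longrightarrow> e \<le> dist x y}"
    have "\<exists>S\<in>\<A>. \<forall>X\<in>\<A>. S \<subseteq> X \<longrightarrow> X = S"
    proof (rule subset_Zorn')
      fix C assume C: "subset.chain \<A> C"
      show "\<Union>C \<in> \<A>"
        unfolding \<A>_def
      proof (intro CollectI ballI impI)
        fix x y assume "x \<in> \<Union>C" "y \<in> \<Union>C" "x \<noteq> y"
        then obtain X Y where "X \<in> C" "x \<in> X" "Y \<in> C" "y \<in> Y" by blast
        moreover from this C have "X \<subseteq> Y \<or> Y \<subseteq> X" "X \<in> \<A>" "Y \<in> \<A>"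
          by (auto simp: subset_chain_def)
        ultimately show "e \<le> dist x y"
          using \<open>x \<noteq> y\<close> unfolding \<A>_def by blast
      qed
    qed
    then obtain S where S: "S \<in> \<A>" and max: "\<And>X. X \<in> \<A> \<Longrightarrow> S \<subseteq> X \<Longrightarrow> X = S" by blast
    have "\<exists>d\<in>S. dist d x < e" for x
    proof (rule ccontr)
      assume neg: "\<not> (\<exists>d\<in>S. dist d x < e)"
      then have "insert x S \<in> \<A>"
        using S by (auto simp: \<A>_def dist_commute not_less)
      then have "x \<in> S" using max[of "insert x S"] by auto
      with neg e show False by auto
    qed
    moreover have "countable S"
    proof -
      \<comment> \<open>Any state can serve as the starting point, because irreducibility speaks of
        all of them.\<close>
      define x0 :: 'x where "x0 = undefined"
      have disj: "disjoint_family_on (\<lambda>d. ball d (e / 2)) S"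
        unfolding disjoint_family_on_def
      proof (intro ballI impI)
        fix c d assume "c \<in> S" "d \<in> S" "c \<noteq> d"
        then have "e \<le> dist c d" using S by (auto simp: \<A>_def)
        then show "ball c (e / 2) \<inter> ball d (e / 2) = {}"
          by (simp add: disjoint_ballI)
      qed
      have "countable {d \<in> S. kpow P s n x0 (ball d (e / 2)) \<noteq> 0}" for n
      proof (rule summable_countable_real, rule nonneg_bdd_above_summable_on)
        have "(\<Sum>d\<in>F. kpow P s n x0 (ball d (e / 2))) \<le> 1" if "F \<subseteq> S" "finite F" for F
          by (rule sum_kpow_le_1) (use that disjoint_family_on_mono[OF _ disj] in auto)
        then show "bdd_above (sum (\<lambda>d. kpow P s n x0 (ball d (e / 2))) ` {F. F \<subseteq> S \<and> finite F})"
          by (intro bdd_aboveI[of _ 1]) auto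
      qed (rule kpow_nonneg)
      then have "countable (\<Union>n. {d \<in> S. kpow P s n x0 (ball d (e / 2)) \<noteq> 0})" by blast
      moreover have "S \<subseteq> (\<Union>n. {d \<in> S. kpow P s n x0 (ball d (e / 2)) \<noteq> 0})"
      proof
        fix d assume "d \<in> S"
        obtain n where "0 < kpow P s n x0 (ball d (e / 2))"
          using irr e unfolding open_set_irreducible_def reachable_def
          by (metis centre_in_ball half_gt_zero open_ball)
        then have "kpow P s n x0 (ball d (e / 2)) \<noteq> 0" by simp
        with \<open>d \<in> S\<close> show "d \<in> (\<Union>n. {d \<in> S. kpow P s n x0 (ball d (e / 2)) \<noteq> 0})" by blast
      qed
      ultimately show ?thesis by (rule countable_subset[rotated])
    qed
    ultimately show ?thesis by blast
  qed
  then have "\<forall>e. \<exists>S::'x set. 0 < e \<longrightarrow> countable S \<and> (\<forall>x. \<exists>d\<in>S. dist d x < e)" by blast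
  from choice[OF this] obtain S :: "real \<Rightarrow> 'x set"
    where S: "\<forall>e. 0 < e \<longrightarrow> countable (S e) \<and> (\<forall>x. \<exists>d\<in>S e. dist d x < e)" ..
  show thesis
  proof
    show "countable (\<Union>n. S (1 / real (Suc n)))" using S by simp
    fix x and e :: real assume "0 < e"
    then obtain n where n: "1 / real (Suc n) < e" using nat_approx_posE by blast
    obtain d where "d \<in> S (1 / real (Suc n))" "dist d x < 1 / real (Suc n)"
      using S[rule_format, of "1 / real (Suc n)"] by auto
    with n show "\<exists>d\<in>(\<Union>n. S (1 / real (Suc n))). dist d x < e" by force
  qed
qed

text \<open>The Borel sets of a product can exceed the product sigma-algebra. A countable dense set
  in the first factor still suffices, since it writes every open set as a countable union of open
  rectangles.\<close>

lemma measurable_graph_map: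
  fixes s :: "'x::metric_space \<Rightarrow> 'a::topological_space"
  assumes "countable (D :: 'x set)" and dense: "\<And>x e. 0 < e \<Longrightarrow> \<exists>d\<in>D. dist d x < e"
    and s: "s \<in> borel_measurable borel"
  shows "(\<lambda>x. (x, s x)) \<in> borel_measurable borel"
proof (rule borel_measurableI)
  fix S :: "('x \<times> 'a) set" assume "open S"
  \<comment> \<open>\<open>V d n\<close> is the largest open set whose rectangle over the given ball
    stays in \<open>S\<close>. One such set per ball takes the place of a countable base of the
    second factor.\<close>
  define V where "V d n = \<Union>{V. open V \<and> ball d (1 / real (Suc n)) \<times> V \<subseteq> S}" for d n
  have V: "open (V d n)" for d n
    unfolding V_def by (rule open_Union) blast
  have "\<exists>d\<in>D. \<exists>n. x \<in> ball d (1 / real (Suc n)) \<and> s x \<in> V d n" if "(x, s x) \<in> S" for x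
  proof -
    from open_prod_elim[OF \<open>open S\<close> that] obtain A B
      where AB: "open A" "open B" "(x, s x) \<in> A \<times> B" "A \<times> B \<subseteq> S" by blast
    then obtain e where e: "0 < e" "ball x e \<subseteq> A" by (auto simp: open_contains_ball)
    obtain n where n: "1 / real (Suc n) < e / 2" using nat_approx_posE[of "e / 2"] e by auto
    obtain d where d: "d \<in> D" "dist d x < 1 / real (Suc n)"
      using dense[of "1 / real (Suc n)" x] by auto
    have "ball d (1 / real (Suc n)) \<subseteq> ball x e"
    proof
      fix y assume "y \<in> ball d (1 / real (Suc n))"
      then show "y \<in> ball x e"
        using d(2) n dist_triangle[of x y d] by (simp add: dist_commute)
    qed
    with e AB have "s x \<in> V d n" by (auto simp: V_def)
    with d show ?thesis by auto
  qed
  moreover have "(x, s x) \<in> S" if "x \<in> ball d (1 / real (Suc n))" "s x \<in> V d n" for x d n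
    using that by (auto simp: V_def)
  ultimately have eq: "(\<lambda>x. (x, s x)) -` S \<inter> space borel
      = (\<Union>d\<in>D. \<Union>n. ball d (1 / real (Suc n)) \<inter> (s -` V d n \<inter> space borel))"
    by auto
  have "s -` V d n \<inter> space borel \<in> sets borel" for d n
    using s V by (intro measurable_sets) auto
  then show "(\<lambda>x. (x, s x)) -` S \<inter> space borel \<in> sets borel"
    unfolding eq using \<open>countable D\<close> by (intro sets.countable_UN' sets.countable_UN sets.Int) auto
qed

text \<open>The set \<open>E\<close> collects finite nets of the compact sets
  \<open>\<Gamma> d\<close> for \<open>d\<close> in \<open>D\<close>. By lower hemicontinuity, a
  point of \<open>\<Gamma> x\<close> is approximated by points of \<open>\<Gamma> d\<close> for
  \<open>d\<close> near \<open>x\<close>, and these by net points.\<close>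

lemma lower_hemicontinuous_separable_range:
  fixes \<Gamma> :: "'x::metric_space \<Rightarrow> 'a::metric_space set"
  assumes lhc: "lower_hemicontinuous \<Gamma>" and comp: "\<And>x. compact (\<Gamma> x)"
    and "countable (D :: 'x set)" and dense: "\<And>x e. 0 < e \<Longrightarrow> \<exists>d\<in>D. dist d x < e"
  obtains E where "countable E" and "\<And>x y e. y \<in> \<Gamma> x \<Longrightarrow> 0 < e \<Longrightarrow> \<exists>d\<in>E. dist d y < e"
proof -
  have "\<exists>k. finite k \<and> \<Gamma> d \<subseteq> (\<Union>z\<in>k. ball z (1 / real (Suc n)))" for d n
    by (rule compactE_image[OF comp[of d], of "\<Gamma> d" "\<lambda>z. ball z (1 / real (Suc n))"]) auto
  then obtain k where k: "\<And>d n. finite (k d n)" "\<And>d n. \<Gamma> d \<subseteq> (\<Union>z\<in>k d n. ball z (1 / real (Suc n)))"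
    by metis
  show thesis
  proof
    show "countable (\<Union>d\<in>D. \<Union>n. k d n)"
      using \<open>countable D\<close> k(1)
      by (intro countable_UN) (auto intro: countable_finite)
    fix x y and e :: real assume y: "y \<in> \<Gamma> x" and e: "0 < e"
    then have "\<Gamma> x \<inter> ball y (e / 2) \<noteq> {}" by (force simp: disjoint_iff)
    then obtain U where U: "open U" "x \<in> U" "\<And>d. d \<in> U \<Longrightarrow> \<Gamma> d \<inter> ball y (e / 2) \<noteq> {}"
      using lhc unfolding lower_hemicontinuous_def by (metis open_ball)
    obtain \<eta> where "0 < \<eta>" "ball x \<eta> \<subseteq> U" using U by (auto simp: open_contains_ball)
    then obtain d where d: "d \<in> D" "d \<in> U"
      using dense[of \<eta> x] by (metis dist_commute mem_ball subsetD)
    then obtain z where z: "z \<in> \<Gamma> d" "dist y z < e / 2" using U(3) by fastforce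
    obtain n where n: "1 / real (Suc n) < e / 2" using nat_approx_posE[of "e / 2"] e by auto
    obtain u where u: "u \<in> k d n" "dist u z < 1 / real (Suc n)"
      using k(2)[of d n] z by auto
    have "dist u y < e"
      using dist_triangle2[of u y z] u z n by linarith
    with u d show "\<exists>d\<in>(\<Union>d\<in>D. \<Union>n. k d n). dist d y < e" by blast
  qed
qed

section \<open>Policies of a Markov decision process\<close>

text \<open>Continuity is known on the graph of \<open>\<Gamma>\<close> only, so the composition
  passes through the Borel space restricted to it.\<close>

lemma policy_measurable_compose:
  assumes s: "s \<in> policies \<Gamma>" and graph: "(\<lambda>x. (x, s x)) \<in> borel_measurable borel"
    and f: "continuous_on (graphG \<Gamma>) f"
  shows "(\<lambda>x. f (x, s x)) \<in> borel_measurable borel"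
proof -
  have "(\<lambda>x. (x, s x)) \<in> borel \<rightarrow>\<^sub>M restrict_space borel (graphG \<Gamma>)"
    using graph s by (intro measurable_restrict_space2) (auto simp: graphG_def policies_def)
  from measurable_compose[OF this borel_measurable_continuous_on_restrict[OF f]] show ?thesis .
qed

text \<open>Measurability of the graph map is a separate hypothesis because it is reached in two
  ways: for the continuous policy directly, and for all other policies from separability, which is
  itself derived from the continuous one.\<close>

lemma discounted_policyI:
  assumes mdp: "is_mdp r \<Gamma> \<beta> P" and s: "s \<in> policies \<Gamma>"
    and graph: "(\<lambda>x. (x, s x)) \<in> borel_measurable borel"
    and bound: "\<And>x a. a \<in> \<Gamma> x \<Longrightarrow> \<bar>r x a\<bar> \<le> C"
  shows "discounted_policy P s r \<beta> C"
proof
  have feas: "s x \<in> \<Gamma> x" for x using s by (simp add: policies_def)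
  show "0 < \<beta>" "\<beta> < 1" using mdp by (auto simp: is_mdp_def)
  show "\<bar>r y (s y)\<bar> \<le> C" for y using bound feas by blast
  show "(\<lambda>y. r y (s y)) \<in> borel_measurable borel"
    using policy_measurable_compose[OF s graph, of "\<lambda>p. r (fst p) (snd p)"] mdp by (simp add: is_mdp_def)
  show "(\<lambda>x. P x (s x)) \<in> borel \<rightarrow>\<^sub>M prob_algebra borel"
  proof (rule measurable_prob_algebra_continuousI)
    show "prob_space (P x (s x))" "sets (P x (s x)) = sets borel" for x
      using mdp feas by (auto simp: is_mdp_def)
    fix f :: "'a \<Rightarrow> real" assume "continuous_on UNIV f" "bounded (range f)"
    then have "continuous_on (graphG \<Gamma>) (\<lambda>p. \<integral>y. f y \<partial>P (fst p) (snd p))"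
      using mdp by (simp add: is_mdp_def)
    from policy_measurable_compose[OF s graph this]
    show "(\<lambda>x. \<integral>y. f y \<partial>P x (s x)) \<in> borel_measurable borel" by simp
  qed
qed

lemma continuous_policy_compose:
  assumes s: "s \<in> policies \<Gamma>" and "continuous_on UNIV s" and f: "continuous_on (graphG \<Gamma>) f"
  shows "continuous_on UNIV (\<lambda>x. f (x, s x))"
  by (rule continuous_on_compose2[OF f])
    (use assms in \<open>auto simp: graphG_def policies_def intro!: continuous_intros\<close>)

text \<open>Continuity keeps \<open>B\<close> positive on a box around \<open>(x0, a0)\<close>
  within the graph, and lower hemicontinuity keeps actions in that box feasible for states near
  \<open>x0\<close>. A measurable selection among them is glued to \<open>\<sigma>\<close> outside a
  neighbourhood of \<open>x0\<close>.\<close>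

lemma local_policy_improvement:
  fixes \<Gamma> :: "'x::metric_space \<Rightarrow> 'a::metric_space set"
  assumes \<Gamma>: "continuous_correspondence \<Gamma>" and comp: "\<And>x. compact (\<Gamma> x)"
    and "countable (D :: 'x set)" and dense: "\<And>x e. 0 < e \<Longrightarrow> \<exists>d\<in>D. dist d x < e"
    and \<sigma>: "\<sigma> \<in> policies \<Gamma>"
    and B: "continuous_on (graphG \<Gamma>) B" and a0: "a0 \<in> \<Gamma> x0" and pos: "0 < (B (x0, a0) :: real)"
  obtains s U where "s \<in> policies \<Gamma>" and "open U" and "x0 \<in> U"
    and "\<And>x. x \<notin> U \<Longrightarrow> s x = \<sigma> x" and "\<And>x. x \<in> U \<Longrightarrow> 0 < B (x, s x)"
proof -
  have uhc: "upper_hemicontinuous \<Gamma>" and lhc: "lower_hemicontinuous \<Gamma>"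
    using \<Gamma> by (auto simp: continuous_correspondence_def)
  obtain W where W: "open W" "W \<inter> graphG \<Gamma> = B -` {0<..} \<inter> graphG \<Gamma>"
  proof -
    have "open {0::real<..}" by (rule open_greaterThan)
    with B have "\<exists>W. open W \<and> W \<inter> graphG \<Gamma> = B -` {0<..} \<inter> graphG \<Gamma>"
      unfolding continuous_on_open_invariant by (elim allE impE)
    then show thesis using that by (elim exE conjE)
  qed
  then have "(x0, a0) \<in> W" using a0 pos by (auto simp: graphG_def)
  then obtain A1 A2 where A: "open A1" "open A2" "(x0, a0) \<in> A1 \<times> A2" "A1 \<times> A2 \<subseteq> W"
    by (rule open_prod_elim[OF W(1)])
  obtain e where e: "0 < e" "cball a0 e \<subseteq> A2" using A by (auto simp: open_contains_cball)
  have "\<Gamma> x0 \<inter> ball a0 e \<noteq> {}" using a0 e by (force simp: disjoint_iff)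
  then obtain U2 where U2: "open U2" "x0 \<in> U2" "\<And>x. x \<in> U2 \<Longrightarrow> \<Gamma> x \<inter> ball a0 e \<noteq> {}"
    using lhc unfolding lower_hemicontinuous_def by (metis open_ball)
  define U where "U = A1 \<inter> U2"
  \<comment> \<open>The closed ball keeps the values compact. They are nonempty on \<open>U\<close>
    because \<open>\<Gamma> x\<close> already meets the open ball there.\<close>
  define F where "F x = (if x \<in> U then \<Gamma> x \<inter> cball a0 e else {\<sigma> x})" for x
  have U: "open U" "x0 \<in> U" using A U2 by (auto simp: U_def)
  have F_sub: "F x \<subseteq> \<Gamma> x" for x
    using \<sigma> by (auto simp: F_def policies_def)
  have F_comp: "compact (F x)" for x
    by (auto simp: F_def intro: compact_Int_closed comp)
  have F_ne: "F x \<noteq> {}" for x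
  proof (cases "x \<in> U")
    case True
    then obtain y where "y \<in> \<Gamma> x" "dist a0 y < e" using U2(3)[of x] by (auto simp: U_def)
    then have "y \<in> F x" using True by (simp add: F_def)
    then show ?thesis by blast
  qed (simp add: F_def)
  \<comment> \<open>This is upper hemicontinuity read through complements.\<close>
  have hit: "closed {x. \<Gamma> x \<inter> C \<noteq> {}}" if "closed C" for C
  proof -
    have "open {x. \<Gamma> x \<subseteq> - C}"
    proof (subst open_subopen, intro ballI)
      fix x assume "x \<in> {x. \<Gamma> x \<subseteq> - C}"
      then show "\<exists>T. open T \<and> x \<in> T \<and> T \<subseteq> {x. \<Gamma> x \<subseteq> - C}"
        using uhc that unfolding upper_hemicontinuous_def by (metis CollectD CollectI open_Compl subsetI)
    qed
    moreover have "- {x. \<Gamma> x \<subseteq> - C} = {x. \<Gamma> x \<inter> C \<noteq> {}}" by auto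
    ultimately show ?thesis using closed_Compl by metis
  qed
  have F_hit: "{x \<in> space borel. F x \<inter> C \<noteq> {}} \<in> sets borel" if C: "closed C" for C
  proof -
    have eq: "{x \<in> space borel. F x \<inter> C \<noteq> {}}
        = (U \<inter> {x. \<Gamma> x \<inter> (cball a0 e \<inter> C) \<noteq> {}}) \<union> (- U \<inter> (\<sigma> -` C \<inter> space borel))"
      by (auto simp: F_def)
    have "\<sigma> -` C \<inter> space borel \<in> sets borel"
      using \<sigma> C by (intro measurable_sets[of \<sigma> borel borel]) (auto simp: policies_def)
    then show ?thesis
      unfolding eq using U hit[OF closed_Int[OF closed_cball C]] by (intro sets.Un sets.Int) auto
  qed
  obtain E where E: "countable E" "\<And>x y e. y \<in> \<Gamma> x \<Longrightarrow> 0 < e \<Longrightarrow> \<exists>d\<in>E. dist d y < e"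
    by (rule lower_hemicontinuous_separable_range[OF lhc comp \<open>countable D\<close> dense]) blast+
  have F_dense: "\<exists>d\<in>E. dist d y < \<epsilon>" if "y \<in> F x" "0 < \<epsilon>" for x y \<epsilon>
    by (rule E(2)[where x = x]) (use F_sub that in auto)
  obtain s where s: "s \<in> borel_measurable borel" "\<And>x. x \<in> space borel \<Longrightarrow> s x \<in> F x"
    by (rule compact_valued_measurable_selection[of borel F E]) (use F_comp F_ne F_hit F_dense E(1) in \<open>auto intro: that\<close>)
  show thesis
  proof
    show "s \<in> policies \<Gamma>" using s F_sub by (auto simp: policies_def)
    show "s x = \<sigma> x" if "x \<notin> U" for x using s(2)[of x] that by (simp add: F_def)
    show "0 < B (x, s x)" if "x \<in> U" for x
    proof -
      have "s x \<in> \<Gamma> x" "s x \<in> cball a0 e" using s(2)[of x] that by (auto simp: F_def)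
      then have "(x, s x) \<in> W \<inter> graphG \<Gamma>"
        using that e A by (auto simp: U_def graphG_def)
      then show ?thesis unfolding W(2) by simp
    qed
  qed (use U in auto)
qed

text \<open>A chain started in \<open>Z\<close> almost surely stays there at every step, and the
  indicator of \<open>U\<close> vanishes on \<open>Z\<close>.\<close>

lemma kpow_eq_0_if_absorbing:
  assumes "\<And>x. x \<in> Z \<Longrightarrow> AE y in P x (s x). y \<in> Z" and "Z \<inter> U = {}" and "x \<in> Z"
  shows "kpow P s n x U = 0"
proof -
  have "\<forall>x\<in>Z. (Pop P s ^^ n) (indicator U) x = 0"
  proof (induction n)
    case 0
    then show ?case using assms(2) by (auto simp: indicator_def)
  next
    case (Suc n)
    show ?case
    proof
      fix x assume "x \<in> Z"
      have "AE y in P x (s x). (Pop P s ^^ n) (indicator U) y = 0"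
        using assms(1)[OF \<open>x \<in> Z\<close>] by eventually_elim (use Suc in blast)
      then show "(Pop P s ^^ Suc n) (indicator U) x = 0"
        by (simp add: Pop_def integral_eq_zero_AE)
    qed
  qed
  with assms(3) show ?thesis by (simp add: kpow_def)
qed

section \<open>Equivalence of the three optimality statements\<close>

theorem theorem4p2:
  fixes r :: "'x::metric_space \<Rightarrow> 'a::metric_space \<Rightarrow> real"
    and \<Gamma> :: "'x \<Rightarrow> 'a set" and \<beta> :: real and P :: "'x \<Rightarrow> 'a \<Rightarrow> 'x measure"
    and \<sigma> :: "'x \<Rightarrow> 'a"
  assumes mdp: "is_mdp r \<Gamma> \<beta> P"
    and pol: "\<sigma> \<in> policies \<Gamma>"
    and irr: "open_set_irreducible (kpow P \<sigma>)"
    and cont: "continuous_on UNIV \<sigma>"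
  shows "((\<exists>x. \<forall>s\<in>policies \<Gamma>. vpol r \<beta> P s x \<le> vpol r \<beta> P \<sigma> x)
            \<longleftrightarrow> (\<exists>\<rho>. prob_space \<rho> \<and> sets \<rho> = sets (borel :: 'x measure) \<and>
                  (\<forall>s\<in>policies \<Gamma>. (\<integral>y. vpol r \<beta> P s y \<partial>\<rho>) \<le> (\<integral>y. vpol r \<beta> P \<sigma> y \<partial>\<rho>))))
       \<and> ((\<exists>\<rho>. prob_space \<rho> \<and> sets \<rho> = sets (borel :: 'x measure) \<and>
                  (\<forall>s\<in>policies \<Gamma>. (\<integral>y. vpol r \<beta> P s y \<partial>\<rho>) \<le> (\<integral>y. vpol r \<beta> P \<sigma> y \<partial>\<rho>)))
            \<longleftrightarrow> optimal_policy r \<Gamma> \<beta> P \<sigma>)"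
    (is "(?E1 \<longleftrightarrow> ?E2) \<and> (?E2 \<longleftrightarrow> ?E3)")
proof -
  obtain C where C: "\<And>x a. a \<in> \<Gamma> x \<Longrightarrow> \<bar>r x a\<bar> \<le> C"
  proof -
    have "bounded ((\<lambda>p. r (fst p) (snd p)) ` graphG \<Gamma>)" using mdp by (simp add: is_mdp_def)
    then show thesis using that by (force simp: bounded_iff graphG_def)
  qed
  let ?v = "vpol r \<beta> P"
  interpret \<sigma>: discounted_policy P \<sigma> r \<beta> C
    by (rule discounted_policyI[OF mdp pol _ C])
      (auto intro!: borel_measurable_continuous_onI continuous_intros cont)
  obtain D where D: "countable D" "\<And>x e. 0 < e \<Longrightarrow> \<exists>d\<in>D. dist d (x::'x) < e"
    using \<sigma>.irreducible_imp_separable[OF irr] by blast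
  \<comment> \<open>Separability now makes every measurable policy a Markov kernel, so the results
    on discounted values apply to each competitor.\<close>
  have dp: "discounted_policy P s r \<beta> C" if "s \<in> policies \<Gamma>" for s
    using that measurable_graph_map[OF D] by (intro discounted_policyI[OF mdp that _ C]) (auto simp: policies_def)
  have v_cont: "continuous_on UNIV (?v \<sigma>)"
  proof (rule \<sigma>.continuous_on_vpol)
    show "continuous_on UNIV (\<lambda>y. r y (\<sigma> y))"
      using continuous_policy_compose[OF pol cont, of "\<lambda>p. r (fst p) (snd p)"] mdp by (simp add: is_mdp_def)
    fix f :: "'x \<Rightarrow> real" assume "continuous_on UNIV f" "bounded (range f)"
    then have "continuous_on (graphG \<Gamma>) (\<lambda>p. \<integral>y. f y \<partial>P (fst p) (snd p))"
      using mdp by (simp add: is_mdp_def)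
    from continuous_policy_compose[OF pol cont this] show "continuous_on UNIV (Pop P \<sigma> f)"
      by (simp add: Pop_def[abs_def])
  qed
  have v_bdd: "bounded (range (?v \<sigma>))"
    using \<sigma>.vpol_abs_le by (auto simp: bounded_iff)

  have E3_imp_E1: "?E1" if opt: ?E3
  proof -
    have "?v s x \<le> ?v \<sigma> x" if "s \<in> policies \<Gamma>" for s x
    proof -
      \<comment> \<open>A real supremum is an upper bound only for bounded sets; the bound
        \<open>C / (1 - \<beta>)\<close> is common to all policies.\<close>
      have "bdd_above ((\<lambda>s. ?v s x) ` policies \<Gamma>)"
        using discounted_policy.vpol_abs_le[OF dp] by (intro bdd_aboveI2) (auto simp: abs_le_iff)
      then have "?v s x \<le> vstar r \<Gamma> \<beta> P x"
        unfolding vstar_def using that by (rule cSUP_upper[rotated])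
      with opt show ?thesis by (simp add: optimal_policy_def)
    qed
    then show ?thesis by blast
  qed

  have E1_imp_E2: ?E2 if E1: ?E1
  proof -
    from E1 obtain x where x: "\<And>s. s \<in> policies \<Gamma> \<Longrightarrow> ?v s x \<le> ?v \<sigma> x" by blast
    \<comment> \<open>The Dirac measure at \<open>x\<close> serves as \<open>\<rho>\<close>.\<close>
    have "(\<integral>y. ?v s y \<partial>return borel x) = ?v s x" if "s \<in> policies \<Gamma>" for s
      using discounted_policy.vpol_measurable[OF dp[OF that]] by (intro integral_return) auto
    with x pol show ?thesis
      by (intro exI[of _ "return borel x"]) (auto simp: prob_space_return)
  qed

  have E2_imp_E3: ?E3 if E2: ?E2
  proof -
    from E2 obtain \<rho> where "prob_space \<rho>" and sets_\<rho>: "sets \<rho> = sets (borel :: 'x measure)"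
      and \<rho>: "\<And>s. s \<in> policies \<Gamma> \<Longrightarrow> (\<integral>y. ?v s y \<partial>\<rho>) \<le> (\<integral>y. ?v \<sigma> y \<partial>\<rho>)" by blast
    interpret \<rho>: prob_space \<rho> by fact
    \<comment> \<open>\<open>B (x, a)\<close> is the gain from playing \<open>a\<close> once at
      \<open>x\<close> and following \<open>\<sigma>\<close> afterwards. It vanishes at
      \<open>a = \<sigma> x\<close> by the fixed point equation.\<close>
    define B where "B p = r (fst p) (snd p) + \<beta> * (\<integral>y. ?v \<sigma> y \<partial>P (fst p) (snd p)) - ?v \<sigma> (fst p)" for p
    have B_cont: "continuous_on (graphG \<Gamma>) B"
    proof -
      have "continuous_on (graphG \<Gamma>) (\<lambda>p. r (fst p) (snd p))"
        and "continuous_on (graphG \<Gamma>) (\<lambda>p. \<integral>y. ?v \<sigma> y \<partial>P (fst p) (snd p))"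
        using mdp v_cont v_bdd by (auto simp: is_mdp_def)
      moreover have "continuous_on (graphG \<Gamma>) (\<lambda>p. ?v \<sigma> (fst p))"
        by (rule continuous_on_compose2[OF v_cont]) (auto intro: continuous_intros)
      ultimately show ?thesis unfolding B_def[abs_def] by (intro continuous_intros)
    qed
    have bellman: "B (x0, a0) \<le> 0" if a0: "a0 \<in> \<Gamma> x0" for x0 a0
    proof (rule ccontr)
      assume "\<not> B (x0, a0) \<le> 0"
      then have pos: "0 < B (x0, a0)" by simp
      have \<Gamma>: "continuous_correspondence \<Gamma>" "\<And>x. compact (\<Gamma> x)" using mdp by (auto simp: is_mdp_def)
      obtain s U where s: "s \<in> policies \<Gamma>" and U: "open U" "x0 \<in> U"
        and off: "\<And>x. x \<notin> U \<Longrightarrow> s x = \<sigma> x" and on: "\<And>x. x \<in> U \<Longrightarrow> 0 < B (x, s x)"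
        by (rule local_policy_improvement[OF \<Gamma> D pol B_cont a0 pos]) blast+
      interpret s: discounted_policy P s r \<beta> C by (rule dp[OF s])
      have B_s: "B (x, s x) = r x (s x) + \<beta> * Pop P s (?v \<sigma>) x - ?v \<sigma> x" for x
        by (simp add: B_def Pop_def)
      have B_nonneg: "0 \<le> B (x, s x)" for x
      proof (cases "x \<in> U")
        case False
        then show ?thesis using \<sigma>.vpol_fixpoint[of x] by (simp add: off B_def Pop_def)
      qed (use on in force)
      define w where "w x = ?v s x - ?v \<sigma> x" for x
      have w_meas: "w \<in> borel_measurable borel"
        unfolding w_def[abs_def] using s.vpol_measurable \<sigma>.vpol_measurable by simp
      have w_bound: "\<bar>w x\<bar> \<le> 2 * (C / (1 - \<beta>))" for x
        using s.vpol_abs_le[of x] \<sigma>.vpol_abs_le[of x] unfolding w_def by linarith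
      have w_nonneg: "0 \<le> w x" for x
        using s.vpol_ge[OF \<sigma>.vpol_measurable \<sigma>.vpol_abs_le, of x] B_nonneg
        by (simp add: B_s w_def)
      \<comment> \<open>The total gain of \<open>s\<close> splits into its one-step gain and the
        discounted expected future gain.\<close>
      have w_eq: "w x = B (x, s x) + \<beta> * Pop P s w x" for x
        using s.vpol_fixpoint[of x]
          s.Pop_diff[OF s.vpol_measurable s.vpol_abs_le \<sigma>.vpol_measurable \<sigma>.vpol_abs_le, of x]
        unfolding w_def[abs_def] B_s by (simp add: right_diff_distrib)
      have Pop_w: "0 \<le> Pop P s w x" for x
        by (rule s.Pop_ge[OF w_meas w_bound w_nonneg])
      have disj: "{x. w x = 0} \<inter> U = {}"
      proof -
        have "0 < w x" if "x \<in> U" for x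
          using w_eq[of x] on[OF that] mult_nonneg_nonneg[OF _ Pop_w[of x], of \<beta>] \<sigma>.\<beta> by linarith
        then show ?thesis by force
      qed
      \<comment> \<open>\<open>w\<close> is superharmonic for \<open>P\<^sub>s\<close>, which agrees with \<open>P\<^sub>\<sigma>\<close> off \<open>U\<close>, so the chain under \<open>\<sigma>\<close> cannot
        leave the zero set of \<open>w\<close> and hence never enters \<open>U\<close> from there.\<close>
      have absorbing: "AE y in P x (\<sigma> x). y \<in> {x. w x = 0}" if "x \<in> {x. w x = 0}" for x
      proof -
        have "s x = \<sigma> x" using that disj off by blast
        have "\<beta> * Pop P s w x \<le> 0" using w_eq[of x] that B_nonneg[of x] by simp
        then have "Pop P s w x = 0" using Pop_w[of x] \<sigma>.\<beta> by (simp add: mult_le_0_iff)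
        then have "(\<integral>y. w y \<partial>P x (s x)) = 0" by (simp add: Pop_def)
        then have "AE y in P x (s x). w y = 0"
          using integral_nonneg_eq_0_iff_AE[OF s.integrable_kernel[OF w_meas w_bound]] w_nonneg by auto
        then show ?thesis unfolding \<open>s x = \<sigma> x\<close> by simp
      qed
      \<comment> \<open>Irreducibility enters a second time: \<open>U\<close> is an open
        neighbourhood of \<open>x0\<close>, so the chain under \<open>\<sigma>\<close> reaches it
        with positive probability from every \<open>x\<close>.\<close>
      have w_pos: "0 < w x" for x
      proof (rule ccontr)
        assume "\<not> 0 < w x"
        then have "x \<in> {x. w x = 0}" using w_nonneg[of x] by simp
        then have "kpow P \<sigma> n x U = 0" for n
          using absorbing disj by (intro kpow_eq_0_if_absorbing)
        moreover have "\<exists>n\<ge>1. 0 < kpow P \<sigma> n x U"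
          using irr U by (auto simp: open_set_irreducible_def reachable_def)
        ultimately show False by simp
      qed
      have int: "integrable \<rho> (?v t)" if "t \<in> policies \<Gamma>" for t
        by (rule \<rho>.integrable_const_bound[where B = "C / (1 - \<beta>)"])
          (use discounted_policy.vpol_abs_le[OF dp[OF that]] discounted_policy.vpol_measurable[OF dp[OF that]]
            measurable_cong_sets[OF sets_\<rho> refl] in auto)
      \<comment> \<open>A strict inequality at every state integrates to a strict one because
        \<open>\<rho>\<close> has positive total mass. This refutes the choice of
        \<open>\<rho>\<close>, wherever its mass lies.\<close>
      have "(\<integral>y. ?v \<sigma> y \<partial>\<rho>) < (\<integral>y. ?v s y \<partial>\<rho>)"
        by (rule \<rho>.integral_less_AE_space[OF int[OF pol] int[OF s]])
          (use w_pos in \<open>auto simp: w_def \<rho>.emeasure_space_1\<close>)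
      with \<rho>[OF s] show False by simp
    qed
    \<comment> \<open>The Bellman inequality bounds the one-step gain of every feasible action,
      hence of every policy, and \<open>vpol_le\<close> extends this to total values.\<close>
    have "?v s x \<le> ?v \<sigma> x" if s: "s \<in> policies \<Gamma>" for s x
    proof -
      interpret s: discounted_policy P s r \<beta> C by (rule dp[OF s])
      show ?thesis
      proof (rule s.vpol_le[OF \<sigma>.vpol_measurable \<sigma>.vpol_abs_le])
        fix y
        have "s y \<in> \<Gamma> y" using s by (simp add: policies_def)
        from bellman[OF this] show "r y (s y) + \<beta> * Pop P s (?v \<sigma>) y \<le> ?v \<sigma> y"
          by (simp add: B_def Pop_def)
      qed
    qed
    then have "vstar r \<Gamma> \<beta> P x = ?v \<sigma> x" for x
      unfolding vstar_def using pol by (intro cSup_eq_maximum) auto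
    then show ?thesis by (simp add: optimal_policy_def)
  qed

  show ?thesis using E3_imp_E1 E1_imp_E2 E2_imp_E3 by blast
qed

end
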